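(* Let $M$ be a positive integer which is not a power of $3$ (i.e. not of the form $3^j$ with $j \ge 0$), and let $\Sigma_{3,\bar 2}\subset\mathbb{Z}_3$ be the set of $3$-adic integers whose $3$-adic expansion omits the digit $2$. Then the Hausdorff dimension of $$\mathcal{C}(1,M) = \Sigma_{3,\bar 2}\cap \tfrac{1}{M}\Sigma_{3,\bar 2} = \{\lambda\in\mathbb{Z}_3 : \lambda\in\Sigma_{3,\bar 2} \text{ and } M\lambda\in\Sigma_{3,\bar 2}\}$$ satisfies $$\dim_H(\mathcal{C}(1,M)) \le \frac12.$$
   Context: Every $3$-adic integer has a unique expansion $\lambda=\sum_{j=0}^\infty d_j 3^j$ with $d_j\in\{0,1,2\}$; it "omits the digit 2" if every $d_j\in\{0,1\}$. $\dim_H$ denotes Hausdorff dimension with respect to the $3$-adic metric on $\mathbb{Z}_3$, normalized so that each residue class modulo $3^j$ has diameter $3^{-j}$. *)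

theory Defs
  imports "HOL-Analysis.Analysis"
begin

section \<open>The ring of 3-adic integers\<close>

text \<open>The 3-adic integers are the inverse limit of the rings \<open>\<int> / 3\<^sup>n \<int>\<close>: an element is a
  sequence of residues \<open>x n \<in> {0, \<dots>, 3\<^sup>n - 1}\<close> compatible under reduction.\<close>

typedef zthree = "{x :: nat \<Rightarrow> int. \<forall>n. x n \<in> {0..<3 ^ n} \<and> x (Suc n) mod 3 ^ n = x n}"
  morphisms residue Abs_zthree
proof
  show "(\<lambda>_. 0) \<in> {x :: nat \<Rightarrow> int. \<forall>n. x n \<in> {0..<3 ^ n} \<and> x (Suc n) mod 3 ^ n = x n}"
    by simp
qed

setup_lifting type_definition_zthree

lemma mod_power_Suc_mod: "(a mod 3 ^ Suc n) mod 3 ^ n = a mod (3 ^ n :: int)"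
  by (rule mod_mod_cancel) simp

lemma compatible_mod:
  assumes "f (Suc n) mod 3 ^ n = f n mod (3 ^ n :: int)"
  shows "f n mod 3 ^ n \<in> {0..<3 ^ n} \<and> f (Suc n) mod 3 ^ Suc n mod 3 ^ n = f n mod 3 ^ n"
  unfolding mod_power_Suc_mod using assms by simp

lemma residue_bounds: "0 \<le> residue x n" "residue x n < 3 ^ n"
  using residue[of x] by auto

lemma residue_mod_self [simp]: "residue x n mod 3 ^ n = residue x n"
  using residue_bounds[of x n] by simp

lemma residue_Suc_mod: "residue x (Suc n) mod 3 ^ n = residue x n"
  using residue[of x] by auto

lemma residue_mod:
  assumes "m \<le> n" shows "residue x n mod 3 ^ m = residue x m"
  using assms
proof (induction n rule: dec_induct)
  case (step n)
  have "residue x (Suc n) mod 3 ^ m = (residue x (Suc n) mod 3 ^ n) mod 3 ^ m"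
    using step.hyps by (intro mod_mod_cancel[symmetric] le_imp_power_dvd) auto
  then show ?case using step.IH by (simp add: residue_Suc_mod)
qed simp

lemma zthree_eqI: "(\<And>n. residue x n = residue y n) \<Longrightarrow> x = y"
  by (metis ext residue_inject)

instantiation zthree :: comm_ring_1
begin

lift_definition zero_zthree :: zthree is "\<lambda>_. 0" by simp

lift_definition one_zthree :: zthree is "\<lambda>n. 1 mod 3 ^ n"
  using compatible_mod[of "\<lambda>_. 1"] by blast

lift_definition plus_zthree :: "zthree \<Rightarrow> zthree \<Rightarrow> zthree" is "\<lambda>x y n. (x n + y n) mod 3 ^ n"
  subgoal for x y n by (rule compatible_mod[of "\<lambda>n. x n + y n"]) (metis mod_add_eq)
  done

lift_definition minus_zthree :: "zthree \<Rightarrow> zthree \<Rightarrow> zthree" is "\<lambda>x y n. (x n - y n) mod 3 ^ n"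
  subgoal for x y n by (rule compatible_mod[of "\<lambda>n. x n - y n"]) (metis mod_diff_eq)
  done

lift_definition uminus_zthree :: "zthree \<Rightarrow> zthree" is "\<lambda>x n. (- x n) mod 3 ^ n"
  subgoal for x n by (rule compatible_mod[of "\<lambda>n. - x n"]) (metis mod_minus_eq)
  done

lift_definition times_zthree :: "zthree \<Rightarrow> zthree \<Rightarrow> zthree" is "\<lambda>x y n. (x n * y n) mod 3 ^ n"
  subgoal for x y n by (rule compatible_mod[of "\<lambda>n. x n * y n"]) (metis mod_mult_eq)
  done

instance
proof
  fix a b c :: zthree
  show "a * b * c = a * (b * c)"
    by (rule zthree_eqI) (simp add: times_zthree.rep_eq mod_simps mult.assoc)
  show "a * b = b * a"
    by (rule zthree_eqI) (simp add: times_zthree.rep_eq mult.commute)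
  show "1 * a = a"
    by (rule zthree_eqI) (simp add: times_zthree.rep_eq one_zthree.rep_eq mod_simps)
  show "a + b + c = a + (b + c)"
    by (rule zthree_eqI) (simp add: plus_zthree.rep_eq mod_simps add.assoc)
  show "a + b = b + a"
    by (rule zthree_eqI) (simp add: plus_zthree.rep_eq add.commute)
  show "0 + a = a"
    by (rule zthree_eqI) (simp add: plus_zthree.rep_eq zero_zthree.rep_eq)
  show "- a + a = 0"
    by (rule zthree_eqI) (simp add: plus_zthree.rep_eq uminus_zthree.rep_eq zero_zthree.rep_eq mod_simps)
  show "a - b = a + - b"
    by (rule zthree_eqI) (simp add: plus_zthree.rep_eq uminus_zthree.rep_eq minus_zthree.rep_eq mod_simps)
  show "(a + b) * c = a * c + b * c"
    by (rule zthree_eqI) (simp add: plus_zthree.rep_eq times_zthree.rep_eq mod_simps distrib_right)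
  have "residue 0 1 \<noteq> residue 1 1"
    by (simp add: zero_zthree.rep_eq one_zthree.rep_eq)
  then show "(0 :: zthree) \<noteq> 1" by metis
qed

end

lemma residue_of_nat: "residue (of_nat k) n = int k mod 3 ^ n"
  by (induction k) (simp_all add: zero_zthree.rep_eq one_zthree.rep_eq plus_zthree.rep_eq mod_simps)

lemma residue_power: "residue (x ^ k) n = residue x n ^ k mod 3 ^ n"
  by (induction k) (simp_all add: one_zthree.rep_eq times_zthree.rep_eq mod_simps)

lemma residue_three: "residue 3 n = 3 mod 3 ^ n"
  using residue_of_nat[of 3 n] by simp

lemma residue_three_power: "residue (3 ^ k) n = 3 ^ k mod 3 ^ n"
  by (simp add: residue_power residue_three mod_simps)

section \<open>The 3-adic metric\<close>

text \<open>For \<open>x \<noteq> y\<close> the \<open>LEAST\<close> below is the 3-adic valuation of \<open>x - y\<close>.\<close>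

instantiation zthree :: metric_space
begin

definition dist_zthree :: "zthree \<Rightarrow> zthree \<Rightarrow> real" where
  "dist x y = (if x = y then 0 else (1 / 3) ^ (LEAST n. residue x (Suc n) \<noteq> residue y (Suc n)))"

definition uniformity_zthree :: "(zthree \<times> zthree) filter" where
  "(uniformity :: (zthree \<times> zthree) filter) = (INF e\<in>{0<..}. principal {(x, y). dist x y < e})"

definition open_zthree :: "zthree set \<Rightarrow> bool" where
  "open (U :: zthree set) \<longleftrightarrow> (\<forall>x\<in>U. \<forall>\<^sub>F (x', y) in uniformity. x' = x \<longrightarrow> y \<in> U)"

lemma dist_zthree_le_iff_residue:
  "dist x y \<le> (1 / 3) ^ n \<longleftrightarrow> residue x n = residue y n" for x y :: zthree
proof (cases "x = y")
  case True
  then show ?thesis by (simp add: dist_zthree_def)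
next
  case False
  define k where "k = (LEAST n. residue x (Suc n) \<noteq> residue y (Suc n))"
  obtain m where m: "residue x m \<noteq> residue y m" using False zthree_eqI by blast
  have "residue z 0 = 0" for z using residue_bounds[of z 0] by simp
  with m obtain m' where "residue x (Suc m') \<noteq> residue y (Suc m')" by (cases m) auto
  then have k: "residue x (Suc k) \<noteq> residue y (Suc k)" unfolding k_def by (rule LeastI)
  have kn: "residue x n = residue y n" if "n \<le> k"
  proof (cases n)
    case 0
    then show ?thesis using \<open>\<And>z. residue z 0 = 0\<close> by simp
  next
    case (Suc j)
    then have "j < k" using that by simp
    then show ?thesis using not_less_Least Suc unfolding k_def by blast
  qed
  have "residue x n \<noteq> residue y n" if "n > k"
    using k that residue_mod[of "Suc k" n] by (metis Suc_leI)
  with kn have "residue x n = residue y n \<longleftrightarrow> n \<le> k" by (meson not_le)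
  also have "\<dots> \<longleftrightarrow> (1 / 3 :: real) ^ k \<le> (1 / 3) ^ n"
    by (subst power_decreasing_iff) auto
  finally show ?thesis using False by (simp add: dist_zthree_def k_def)
qed

lemma dist_zthree_cases: "dist x y = 0 \<or> (\<exists>n. dist x y = (1 / 3) ^ n)" for x y :: zthree
  by (auto simp: dist_zthree_def)

instance
proof
  fix x y z :: zthree
  show "dist x y = 0 \<longleftrightarrow> x = y" by (simp add: dist_zthree_def)
  show "dist x y \<le> dist x z + dist y z"
  proof -
    have *: "dist x y \<le> max (dist x z) (dist y z)"
    proof (cases "max (dist x z) (dist y z) = 0")
      case True
      moreover have "dist x z \<ge> 0" "dist y z \<ge> 0" by (auto simp: dist_zthree_def)
      ultimately have "dist x z = 0" "dist y z = 0" by linarith+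
      then have "x = z" "y = z" by (auto simp: dist_zthree_def split: if_splits)
      then show ?thesis by (simp add: dist_zthree_def)
    next
      case False
      moreover have "max (dist x z) (dist y z) \<in> {dist x z, dist y z}" by (simp add: max_def)
      ultimately obtain n where n: "max (dist x z) (dist y z) = (1 / 3) ^ n"
        using dist_zthree_cases[of x z] dist_zthree_cases[of y z] by auto
      then have "dist x z \<le> (1 / 3) ^ n" "dist y z \<le> (1 / 3) ^ n" by linarith+
      then show ?thesis unfolding n dist_zthree_le_iff_residue by simp
    qed
    moreover have "dist x z \<ge> 0" "dist y z \<ge> 0" by (auto simp: dist_zthree_def)
    ultimately show ?thesis by linarith
  qed
qed (auto simp: uniformity_zthree_def open_zthree_def)

end

lemma residue_eq_iff_dvd: "residue x n = residue y n \<longleftrightarrow> 3 ^ n dvd x - y"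
proof
  assume "3 ^ n dvd x - y"
  then obtain q where "x - y = 3 ^ n * q" by (elim dvdE)
  then have "x = y + 3 ^ n * q" by (simp add: algebra_simps)
  then show "residue x n = residue y n"
    by (simp add: plus_zthree.rep_eq times_zthree.rep_eq residue_three_power)
next
  assume eq: "residue x n = residue y n"
  define d where "d = x - y"
  have d0: "residue d n = 0" by (simp add: d_def minus_zthree.rep_eq eq)
  have dv: "3 ^ n dvd residue d (m + n)" for m
    using residue_mod[of n "m + n" d] d0 by (simp add: dvd_eq_mod_eq_0)
  define q where "q = (\<lambda>m. residue d (m + n) div 3 ^ n)"
  have qd: "residue d (m + n) = 3 ^ n * q m" for m using dv by (simp add: q_def)
  have "q m \<in> {0..<3 ^ m} \<and> q (Suc m) mod 3 ^ m = q m" for m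
  proof -
    have "0 \<le> 3 ^ n * q m" "3 ^ n * q m < 3 ^ (m + n)"
      using residue_bounds[of d "m + n"] qd by metis+
    then have "3 ^ n * 0 \<le> 3 ^ n * q m" "3 ^ n * q m < 3 ^ n * 3 ^ m"
      by (simp_all add: power_add mult.commute)
    then have "0 \<le> q m" "q m < 3 ^ m"
      by (simp_all only: mult_le_cancel_left_pos mult_less_cancel_left_pos zero_less_power zero_less_numeral)
    moreover have "3 ^ n * q (Suc m) mod (3 ^ n * 3 ^ m) = 3 ^ n * q m"
      using residue_mod[of "m + n" "Suc m + n" d] unfolding qd power_add
      by (simp add: mult.commute)
    ultimately show ?thesis by simp
  qed
  then have "residue (Abs_zthree q) = q" by (intro Abs_zthree_inverse) auto
  then have "residue (3 ^ n * Abs_zthree q) m = residue d m" for m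
    using qd[of m] residue_mod[of m "m + n" d]
    by (simp add: times_zthree.rep_eq residue_three_power mod_simps)
  then have "d = 3 ^ n * Abs_zthree q" by (intro zthree_eqI) simp
  then show "3 ^ n dvd x - y" by (simp add: d_def)
qed

lemma dist_zthree_le_iff_dvd: "dist x y \<le> (1 / 3) ^ n \<longleftrightarrow> 3 ^ n dvd x - y" for x y :: zthree
  by (simp add: dist_zthree_le_iff_residue residue_eq_iff_dvd)

lemma diameter_residue_class: "diameter {y :: zthree. 3 ^ n dvd y - x} = (1 / 3) ^ n"
proof (rule antisym)
  let ?S = "{y :: zthree. 3 ^ n dvd y - x}"
  have le: "dist a b \<le> (1 / 3) ^ n" if "a \<in> ?S" "b \<in> ?S" for a b
    using that by (simp flip: residue_eq_iff_dvd add: dist_zthree_le_iff_residue)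
  have x: "x \<in> ?S" "x + 3 ^ n \<in> ?S" by simp_all
  show "diameter ?S \<le> (1 / 3) ^ n"
    unfolding diameter_def using x(1) le by (auto intro!: cSUP_least)
  have "bounded ?S"
    unfolding bounded_def using le[OF x(1)] by blast
  then have *: "dist (x + 3 ^ n) x \<le> diameter ?S"
    using x by (intro diameter_bounded_bound) auto
  have "residue (3 ^ n) (Suc n) \<noteq> residue 0 (Suc n)"
    by (simp add: residue_three_power zero_zthree.rep_eq)
  then have "\<not> 3 ^ Suc n dvd (3 ^ n :: zthree)"
    by (simp add: residue_eq_iff_dvd)
  then have "\<not> dist (x + 3 ^ n) x \<le> (1 / 3) ^ Suc n"
    unfolding dist_zthree_le_iff_dvd by simp
  moreover have "dist (x + 3 ^ n) x \<le> (1 / 3) ^ n"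
    unfolding dist_zthree_le_iff_dvd by simp
  moreover obtain k where k: "dist (x + 3 ^ n) x = (1 / 3) ^ k"
    using dist_zthree_cases[of "x + 3 ^ n" x] calculation(1)
    by (metis power_one_over zero_le_power zero_le_divide_1_iff zero_le_numeral)
  moreover have "(1 / 3 :: real) ^ k \<le> (1 / 3) ^ m \<longleftrightarrow> m \<le> k" for m
    by (rule power_decreasing_iff) auto
  ultimately have "\<not> Suc n \<le> k" "n \<le> k" by metis+
  then have "k = n" by linarith
  with * k show "(1 / 3) ^ n \<le> diameter ?S" by metis
qed

section \<open>Digit expansions\<close>

definition digit_expansion :: "(nat \<Rightarrow> nat) \<Rightarrow> zthree \<Rightarrow> bool" where
  "digit_expansion d x \<longleftrightarrow> (\<forall>j. d j \<in> {0, 1, 2}) \<and> (\<lambda>j. of_nat (d j) * 3 ^ j) sums x"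

definition omits_two :: "zthree set" where
  "omits_two = {x. \<exists>d. digit_expansion d x \<and> (\<forall>j. d j \<noteq> 2)}"

lemma digit_sum_less:
  fixes d :: "nat \<Rightarrow> nat"
  assumes "\<And>j. d j \<le> 2"
  shows "(\<Sum>j<n. d j * 3 ^ j) < 3 ^ n"
proof (induction n)
  case (Suc n)
  have "d n * 3 ^ n \<le> 2 * 3 ^ n" using assms by simp
  moreover have "(\<Sum>j<Suc n. d j * 3 ^ j) = (\<Sum>j<n. d j * 3 ^ j) + d n * 3 ^ n" by simp
  moreover have "(3 :: nat) ^ Suc n = 3 ^ n + 2 * 3 ^ n" by simp
  ultimately show ?case using Suc by linarith
qed simp

lemma digit_sum_mod:
  fixes d :: "nat \<Rightarrow> nat"
  assumes "\<And>j. d j \<le> 2" "n \<le> m"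
  shows "(\<Sum>j<m. d j * 3 ^ j) mod 3 ^ n = (\<Sum>j<n. d j * 3 ^ j)"
  using assms(2)
proof (induction m rule: dec_induct)
  case base
  then show ?case using digit_sum_less[OF assms(1)] by simp
next
  case (step m)
  have "(3 :: nat) ^ n dvd d m * 3 ^ m"
    using step.hyps by (simp add: le_imp_power_dvd)
  then show ?case using step.IH by (simp add: mod_add_right_eq [symmetric])
qed

lemma digit_expansion_iff_residue:
  "digit_expansion d x \<longleftrightarrow>
    (\<forall>j. d j \<in> {0, 1, 2}) \<and> (\<forall>n. residue x n = int (\<Sum>j<n. d j * 3 ^ j))"
proof (cases "\<forall>j. d j \<in> {0, 1, 2}")
  case True
  have d: "d j \<le> 2" for j using True[rule_format, of j] by auto
  define S where "S = (\<lambda>m. \<Sum>j<m. of_nat (d j) * 3 ^ j :: zthree)"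
  have S: "residue (S m) n = int (\<Sum>j<n. d j * 3 ^ j)" if "n \<le> m" for m n
  proof -
    have "S m = of_nat (\<Sum>j<m. d j * 3 ^ j)" by (simp add: S_def)
    then have "residue (S m) n = int ((\<Sum>j<m. d j * 3 ^ j) mod 3 ^ n)"
      by (simp only: residue_of_nat zmod_int of_nat_power of_nat_numeral)
    then show ?thesis using digit_sum_mod[OF d that] by simp
  qed
  have "S \<longlonglongrightarrow> x \<longleftrightarrow> (\<forall>n. residue x n = int (\<Sum>j<n. d j * 3 ^ j))"
  proof safe
    fix n assume "S \<longlonglongrightarrow> x"
    then have "\<forall>\<^sub>F m in sequentially. dist (S m) x < (1 / 3) ^ n"
      by (rule tendstoD) simp
    then obtain m where "m \<ge> n" "dist (S m) x < (1 / 3) ^ n"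
      by (auto simp: eventually_sequentially) (meson nle_le)
    then show "residue x n = int (\<Sum>j<n. d j * 3 ^ j)"
      using S dist_zthree_le_iff_residue[of "S m" x n] by simp
  next
    assume r: "\<forall>n. residue x n = int (\<Sum>j<n. d j * 3 ^ j)"
    show "S \<longlonglongrightarrow> x"
    proof (rule tendstoI)
      fix e :: real assume "e > 0"
      then obtain n where n: "(1 / 3) ^ n < e"
        using real_arch_pow_inv[of e "1 / 3"] by auto
      have "dist (S m) x < e" if "m \<ge> n" for m
        using S[OF that] r n dist_zthree_le_iff_residue[of "S m" x n] by simp
      then show "\<forall>\<^sub>F m in sequentially. dist (S m) x < e"
        by (auto simp: eventually_sequentially)
    qed
  qed
  then show ?thesis using True by (simp add: digit_expansion_def sums_def S_def)
qed (auto simp only: digit_expansion_def)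

theorem digit_expansion_unique: "\<exists>!d. digit_expansion d x"
proof (rule ex1I)
  define d where "d = (\<lambda>j. nat (residue x (Suc j) div 3 ^ j))"
  have nn: "0 \<le> residue x (Suc j) div 3 ^ j" for j
    using residue_bounds(1)[of x "Suc j"] by (simp add: pos_imp_zdiv_nonneg_iff)
  have d2: "d j \<in> {0, 1, 2}" for j
  proof -
    have "residue x (Suc j) div 3 ^ j * 3 ^ j \<le> residue x (Suc j)"
      using minus_mod_eq_div_mult[of "residue x (Suc j)" "3 ^ j"] residue_bounds(1)[of x j]
      unfolding residue_Suc_mod by linarith
    also have "\<dots> < 3 * 3 ^ j" using residue_bounds(2)[of x "Suc j"] by simp
    finally have "residue x (Suc j) div 3 ^ j < 3"
      by (rule mult_right_less_imp_less) simp
    then have "d j < 3" unfolding d_def by linarith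
    then have "d j = 0 \<or> d j = 1 \<or> d j = 2" by linarith
    then show ?thesis by simp
  qed
  have "residue x n = int (\<Sum>j<n. d j * 3 ^ j)" for n
  proof (induction n)
    case 0
    then show ?case using residue_bounds[of x 0] by simp
  next
    case (Suc n)
    have "residue x (Suc n) = residue x (Suc n) div 3 ^ n * 3 ^ n + residue x n"
      using div_mult_mod_eq[of "residue x (Suc n)" "3 ^ n"] unfolding residue_Suc_mod by (rule sym)
    then show ?case using Suc nn[of n] by (simp add: d_def)
  qed
  with d2 show "digit_expansion d x" by (simp add: digit_expansion_iff_residue)
  fix e assume "digit_expansion e x"
  then have e: "e j \<in> {0, 1, 2}" "residue x n = int (\<Sum>j<n. e j * 3 ^ j)" for j n
    by (auto simp: digit_expansion_iff_residue)
  show "e = d"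
  proof
    fix j
    have "residue x (Suc j) = residue x j + int (e j) * 3 ^ j" by (simp add: e(2))
    then have "residue x (Suc j) div 3 ^ j = int (e j)"
      using residue_bounds[of x j] by simp
    then show "e j = d j" by (simp add: d_def)
  qed
qed

section \<open>Hausdorff dimension\<close>

text \<open>The convention is \<open>0\<^sup>0 = 1\<close> for the diameter of a nonempty set, so that
  \<open>hausdorff_measure 0\<close> is the counting measure; note that \<open>0 powr 0 = 0\<close> for reals.\<close>

definition diameter_power :: "real \<Rightarrow> 'a::metric_space set \<Rightarrow> ennreal" where
  "diameter_power s U = (if U = {} then 0 else if s = 0 then 1 else ennreal (diameter U powr s))"

text \<open>Boundedness of the covering sets is required explicitly since \<^const>\<open>diameter\<close> is
  meaningful only for bounded sets. The infimum is \<open>\<infinity>\<close> if no cover exists.\<close>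

definition hausdorff_premeasure :: "real \<Rightarrow> real \<Rightarrow> 'a::metric_space set \<Rightarrow> ennreal" where
  "hausdorff_premeasure s \<delta> A =
     Inf {\<Sum>i. diameter_power s (U i) | U :: nat \<Rightarrow> 'a set.
            A \<subseteq> (\<Union>i. U i) \<and> (\<forall>i. bounded (U i) \<and> diameter (U i) \<le> \<delta>)}"

definition hausdorff_measure :: "real \<Rightarrow> 'a::metric_space set \<Rightarrow> ennreal" where
  "hausdorff_measure s A = (SUP \<delta>\<in>{0<..}. hausdorff_premeasure s \<delta> A)"

definition hausdorff_dim :: "'a::metric_space set \<Rightarrow> ennreal" where
  "hausdorff_dim A = Inf {ennreal s | s. s \<ge> 0 \<and> hausdorff_measure s A = 0}"

end

theory Submission
  imports Defs "HOL-Number_Theory.Cong"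
begin

text \<open>Multiplication by 3 shifts the expansion, so \<open>M\<close> may be assumed prime to 3; if
  \<open>M \<equiv> 2 mod 3\<close>, comparing lowest nonzero digits leaves only \<open>x = 0\<close>. Otherwise
  \<open>M = 1 + 3\<^sup>m a\<close> with \<open>m \<ge> 1\<close> and \<open>a\<close> prime to 3. The differences \<open>t\<^sub>j \<in> {-1, 0, 1}\<close> of the
  digits of \<open>M x\<close> and \<open>x\<close> are the balanced ternary digits of \<open>3\<^sup>m a x\<close>, so
  \<open>t\<^sub>0, \<dots>, t\<^sub>n\<^sub>+\<^sub>m\<^sub>-\<^sub>1\<close> and the first \<open>n\<close> digits of \<open>x\<close> determine each other. Two choices of the
  \<open>n\<close>-th digit of \<open>x\<close> are possible only if \<open>t\<^sub>n = 0\<close>, and they lead to different values of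
  \<open>t\<^sub>n\<^sub>+\<^sub>m\<close>. Weight a prefix of length \<open>n\<close> by \<open>\<surd>3\<close> to the number of zeros among
  \<open>t\<^sub>n, \<dots>, t\<^sub>n\<^sub>+\<^sub>m\<^sub>-\<^sub>1\<close>. Since \<open>\<surd>3 + 1 \<le> 3\<close>, the total weight grows by a factor of at most
  \<open>\<surd>3\<close> per digit, so there are \<open>O(3\<^sup>n\<^sup>/\<^sup>2)\<close> prefixes of length \<open>n\<close>.\<close>

section \<open>Box counting\<close>

lemma finite_residue_image: "finite ((\<lambda>x. residue x n) ` A)"
  by (rule finite_subset[of _ "{0..<3 ^ n}"]) (auto simp: residue_bounds)

text \<open>The classes modulo \<open>3 ^ n\<close> that meet \<open>A\<close> cover it, and each
  part has diameter at most \<open>(1 / 3) ^ n\<close>.\<close>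

lemma hausdorff_premeasure_le_residue_count:
  fixes A :: "zthree set"
  assumes "t > 0" "(1 / 3) ^ n \<le> \<delta>"
  shows "hausdorff_premeasure t \<delta> A
    \<le> ennreal (real (card ((\<lambda>x. residue x n) ` A)) * 3 powr (- t * real n))"
proof -
  define R where "R = (\<lambda>x. residue x n) ` A"
  define U where "U = (\<lambda>i. {x \<in> A. residue x n = int i})"
  have dist: "dist x y \<le> (1 / 3) ^ n" if "x \<in> U i" "y \<in> U i" for x y i
    using that by (simp add: U_def dist_zthree_le_iff_residue)
  have diam: "diameter (U i) \<le> (1 / 3) ^ n" for i
    using dist[of _ i] by (auto simp: diameter_def intro!: cSUP_least)
  have bdd: "bounded (U i)" for i
    using dist[of _ i] unfolding bounded_def by blast
  have cover: "A \<subseteq> (\<Union>i. U i)"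
  proof
    fix x assume "x \<in> A"
    then have "x \<in> U (nat (residue x n))" using residue_bounds[of x n] by (simp add: U_def)
    then show "x \<in> (\<Union>i. U i)" by blast
  qed
  have pow: "diameter_power t (U i) \<le> ennreal (3 powr (- t * real n))" for i
  proof -
    have "diameter (U i) powr t \<le> ((1 / 3) ^ n) powr t"
      using diam[of i] bdd[of i] assms(1) by (intro powr_mono2) (auto intro: diameter_ge_0)
    also have "(1 / 3 :: real) ^ n = 3 powr (- real n)"
      by (simp add: powr_minus_divide powr_realpow power_divide)
    finally have "diameter (U i) powr t \<le> 3 powr (- t * real n)"
      by (simp add: powr_powr mult.commute)
    then show ?thesis
      using assms(1) by (auto simp: diameter_power_def intro: ennreal_leI)
  qed
  have empty: "diameter_power t (U i) = 0" if "i \<notin> nat ` R" for i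
  proof -
    have "U i = {}" using that by (force simp: U_def R_def)
    then show ?thesis by (simp add: diameter_power_def)
  qed
  have finR: "finite R" unfolding R_def by (rule finite_residue_image)
  have "hausdorff_premeasure t \<delta> A \<le> (\<Sum>i. diameter_power t (U i))"
    unfolding hausdorff_premeasure_def
    by (intro Inf_lower CollectI exI[of _ U] conjI refl cover allI bdd order_trans[OF diam assms(2)])
  also have "\<dots> = (\<Sum>i\<in>nat ` R. diameter_power t (U i))"
    using finR empty by (intro suminf_finite) auto
  also have "\<dots> \<le> (\<Sum>i\<in>nat ` R. ennreal (3 powr (- t * real n)))"
    by (rule sum_mono) (rule pow)
  also have "\<dots> = ennreal (real (card (nat ` R)) * 3 powr (- t * real n))"
    by (simp add: ennreal_of_nat_eq_real_of_nat ennreal_mult)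
  also have "\<dots> \<le> ennreal (real (card R) * 3 powr (- t * real n))"
    using finR by (intro ennreal_leI mult_right_mono) (auto intro: card_image_le)
  finally show ?thesis by (simp add: R_def)
qed

text \<open>At exponent \<open>s + e\<close> these covers cost at most
  \<open>K * (3 powr (- e)) ^ n\<close>, which tends to 0, so \<open>A\<close> is null for every
  exponent above \<open>s\<close>.\<close>

lemma hausdorff_dim_le_box_counting:
  fixes A :: "zthree set"
  assumes "s \<ge> 0"
    and count: "\<And>n. real (card ((\<lambda>x. residue x n) ` A)) \<le> K * 3 powr (s * real n)"
  shows "hausdorff_dim A \<le> ennreal s"
proof (rule ennreal_le_epsilon)
  fix e :: real assume "e > 0"
  have "hausdorff_premeasure (s + e) \<delta> A = 0" if "\<delta> > 0" for \<delta> :: real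
  proof -
    have bound: "hausdorff_premeasure (s + e) \<delta> A \<le> ennreal (K * (3 powr (- e)) ^ n)"
      if "(1 / 3) ^ n \<le> \<delta>" for n
    proof -
      have "real (card ((\<lambda>x. residue x n) ` A)) * 3 powr (- (s + e) * real n)
          \<le> K * 3 powr (s * real n) * 3 powr (- (s + e) * real n)"
        by (intro mult_right_mono count) simp
      also have "\<dots> = K * (3 powr (- e)) ^ n"
        by (simp add: powr_power mult.assoc flip: powr_add) (simp add: algebra_simps)
      finally show ?thesis
        using hausdorff_premeasure_le_residue_count[of "s + e" n \<delta> A] that \<open>e > 0\<close> assms(1)
        by (meson add_nonneg_pos ennreal_leI order_trans)
    qed
    have "(\<lambda>n. (3 powr (- e)) ^ n) \<longlonglongrightarrow> (0 :: real)"
      using \<open>e > 0\<close> by (intro LIMSEQ_realpow_zero) (auto simp: powr_less_one)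
    then have "(\<lambda>n. ennreal (K * (3 powr (- e)) ^ n)) \<longlonglongrightarrow> ennreal (K * 0)"
      by (intro tendsto_ennrealI tendsto_mult_left)
    moreover have "\<forall>\<^sub>F n in sequentially. (1 / 3 :: real) ^ n < \<delta>"
      using LIMSEQ_realpow_zero[of "1 / 3 :: real"] \<open>\<delta> > 0\<close> by (intro order_tendstoD) auto
    then have "\<forall>\<^sub>F n in sequentially.
        hausdorff_premeasure (s + e) \<delta> A \<le> ennreal (K * (3 powr (- e)) ^ n)"
      by eventually_elim (use bound in simp)
    ultimately have "hausdorff_premeasure (s + e) \<delta> A \<le> ennreal (K * 0)"
      by (intro tendsto_lowerbound) auto
    then show ?thesis by simp
  qed
  then have "hausdorff_measure (s + e) A = 0"
    by (simp add: hausdorff_measure_def)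
  then have "hausdorff_dim A \<le> ennreal (s + e)"
    unfolding hausdorff_dim_def using assms(1) \<open>e > 0\<close>
    by (intro Inf_lower CollectI exI[of _ "s + e"]) auto
  then show "hausdorff_dim A \<le> ennreal s + ennreal e"
    using assms(1) \<open>e > 0\<close> by simp
qed

section \<open>Digits of multiples\<close>

lemma residue_0 [simp]: "residue x 0 = 0"
  using residue_bounds[of x 0] by simp

text \<open>Consecutive residues differ by the \<open>n\<close>-th digit times
  \<open>3 ^ n\<close>.\<close>

lemma omits_two_iff_residue:
  "x \<in> omits_two \<longleftrightarrow> (\<forall>n. residue x (Suc n) - residue x n \<in> {0, 3 ^ n})"
proof
  assume "x \<in> omits_two"
  then obtain d where d: "digit_expansion d x" "\<And>j. d j \<noteq> 2" unfolding omits_two_def by blast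
  show "\<forall>n. residue x (Suc n) - residue x n \<in> {0, 3 ^ n}"
  proof
    fix n
    have "d n = 0 \<or> d n = 1" "residue x (Suc n) = residue x n + int (d n) * 3 ^ n"
      using d by (auto simp: digit_expansion_iff_residue)
    then show "residue x (Suc n) - residue x n \<in> {0, 3 ^ n}" by auto
  qed
next
  assume *: "\<forall>n. residue x (Suc n) - residue x n \<in> {0, 3 ^ n}"
  define d :: "nat \<Rightarrow> nat" where "d = (\<lambda>n. if residue x (Suc n) = residue x n then 0 else 1)"
  have "residue x n = int (\<Sum>j<n. d j * 3 ^ j)" for n
  proof (induction n)
    case 0
    then show ?case by simp
  next
    case (Suc n)
    then show ?case using *[rule_format, of n] by (auto simp: d_def)
  qed
  moreover have d: "d j \<in> {0, 1, 2}" "d j \<noteq> 2" for j by (simp_all add: d_def)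
  ultimately have "digit_expansion d x" unfolding digit_expansion_iff_residue by blast
  then show "x \<in> omits_two" unfolding omits_two_def using d by blast
qed

lemma residue_of_nat_mult: "residue (of_nat k * x) n = int k * residue x n mod 3 ^ n"
  by (simp add: times_zthree.rep_eq residue_of_nat mod_simps)

lemma omits_two_three_mult: "3 * x \<in> omits_two \<Longrightarrow> x \<in> omits_two"
proof -
  assume *: "3 * x \<in> omits_two"
  have shift: "residue (3 * x) (Suc n) = 3 * residue x n" for n
    using residue_of_nat_mult[of 3 x "Suc n"] residue_mod[of n "Suc n" x]
    by (simp add: mult_mod_right)
  have "3 * residue x (Suc n) - 3 * residue x n \<in> {0, 3 * 3 ^ n}" for n
    using *[unfolded omits_two_iff_residue, rule_format, of "Suc n"] unfolding shift by simp
  then show "x \<in> omits_two" unfolding omits_two_iff_residue by force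
qed

lemma omits_two_three_power_mult: "3 ^ k * x \<in> omits_two \<Longrightarrow> x \<in> omits_two"
  by (induction k) (auto simp: mult.assoc intro: omits_two_three_mult)

text \<open>If the lowest nonzero digit of \<open>x\<close> were 1 at place \<open>n\<close>, the
  digit of \<open>of_nat M * x\<close> there would be \<open>M mod 3\<close>, which is 2.\<close>

lemma omits_two_multiple_eq_0:
  assumes "x \<in> omits_two" "of_nat M * x \<in> omits_two" "M mod 3 = 2"
  shows "residue x n = 0"
proof (induction n)
  case 0
  then show ?case by simp
next
  case (Suc n)
  have "residue x (Suc n) \<noteq> 3 ^ n"
  proof
    assume "residue x (Suc n) = 3 ^ n"
    then have "residue (of_nat M * x) (Suc n) = (int M mod 3) * 3 ^ n"
      unfolding residue_of_nat_mult by (simp add: mult_mod_left)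
    also have "int M mod 3 = 2" using assms(3) by presburger
    finally have "residue (of_nat M * x) (Suc n) = 2 * 3 ^ n" .
    moreover have "residue (of_nat M * x) n = 0" using Suc by (simp add: residue_of_nat_mult)
    ultimately show False
      using assms(2)[unfolded omits_two_iff_residue, rule_format, of n] by simp
  qed
  then show ?case
    using assms(1)[unfolded omits_two_iff_residue, rule_format, of n] Suc by auto
qed

section \<open>Counting prefixes\<close>

text \<open>If \<open>\<lambda>\<^sub>j\<close> and \<open>\<mu>\<^sub>j\<close> are the digits of \<open>x\<close> and \<open>M x\<close>, this is the sum of
  \<open>(\<mu>\<^sub>j - \<lambda>\<^sub>j) 3\<^sup>j\<close> over \<open>j < n\<close>, that is, a truncated balanced ternary expansion of \<open>(M - 1) x\<close>.\<close>

definition balanced_part :: "nat \<Rightarrow> zthree \<Rightarrow> nat \<Rightarrow> int" where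
  "balanced_part M x n = residue (of_nat M * x) n - residue x n"

text \<open>The larger factor marks a zero balanced digit, the only place where a prefix can
  branch.\<close>

definition step_weight :: "nat \<Rightarrow> zthree \<Rightarrow> nat \<Rightarrow> real" where
  "step_weight M x j = (if balanced_part M x (Suc j) = balanced_part M x j then sqrt 3 else 1)"

locale multiplier =
  fixes M a m :: nat
  assumes M_eq: "M = 1 + 3 ^ m * a" and not_dvd: "\<not> 3 dvd a"
begin

definition C :: "zthree set" where
  "C = {x. x \<in> omits_two \<and> of_nat M * x \<in> omits_two}"

text \<open>For \<open>x\<close> in \<open>C\<close> the window holds the balanced digits that the
  first \<open>n\<close> digits of \<open>x\<close> already fix; its zeros mark the next
  \<open>m\<close> places where branching remains possible.\<close>

definition weight :: "nat \<Rightarrow> zthree \<Rightarrow> real" where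
  "weight n x = (\<Prod>i=n..<n + m. step_weight M x i)"

lemma balanced_part_cong: "[balanced_part M x n = int (3 ^ m * a) * residue x n] (mod 3 ^ n)"
proof -
  have "[residue (of_nat M * x) n = int M * residue x n] (mod 3 ^ n)"
    by (simp add: cong_def residue_of_nat_mult)
  then have "[balanced_part M x n = int M * residue x n - residue x n] (mod 3 ^ n)"
    unfolding balanced_part_def by (rule cong_diff) simp
  then show ?thesis by (simp add: M_eq algebra_simps)
qed

text \<open>The factor \<open>3 ^ m\<close> costs \<open>m\<close> places, and \<open>a\<close> is
  invertible modulo \<open>3 ^ n\<close>.\<close>

lemma balanced_part_cong_iff:
  "[balanced_part M x (m + n) = balanced_part M y (m + n)] (mod 3 ^ (m + n))
    \<longleftrightarrow> residue x n = residue y n"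
proof -
  let ?x = "residue x (m + n)" and ?y = "residue y (m + n)"
  have "[balanced_part M x (m + n) = balanced_part M y (m + n)] (mod 3 ^ (m + n))
    \<longleftrightarrow> [int (3 ^ m * a) * ?x = int (3 ^ m * a) * ?y] (mod 3 ^ (m + n))"
    by (meson balanced_part_cong cong_sym cong_trans)
  also have "\<dots> \<longleftrightarrow> 3 ^ m * 3 ^ n dvd 3 ^ m * (int a * (?x - ?y))"
    by (simp add: cong_iff_dvd_diff power_add algebra_simps)
  also have "\<dots> \<longleftrightarrow> 3 ^ n dvd int a * (?x - ?y)"
    by (rule dvd_times_left_cancel_iff) simp
  also have "\<dots> \<longleftrightarrow> 3 ^ n dvd ?x - ?y"
  proof (rule coprime_dvd_mult_right_iff)
    have "\<not> 3 dvd int a" using not_dvd by presburger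
    then have "coprime 3 (int a)" by (intro prime_imp_coprime) auto
    then show "coprime (3 ^ n) (int a)" by simp
  qed
  also have "\<dots> \<longleftrightarrow> residue x n = residue y n"
    using residue_mod[of n "m + n"] by (simp add: mod_eq_dvd_iff[symmetric])
  finally show ?thesis .
qed

lemma balanced_part_step:
  assumes "x \<in> C"
  shows "balanced_part M x (Suc j) - balanced_part M x j \<in> {- (3 ^ j), 0, 3 ^ j}"
  using assms[unfolded C_def omits_two_iff_residue, simplified, THEN conjunct1, rule_format, of j]
    assms[unfolded C_def omits_two_iff_residue, simplified, THEN conjunct2, rule_format, of j]
  by (auto simp: balanced_part_def)

text \<open>Uniqueness of balanced ternary expansions modulo powers of 3.\<close>

lemma balanced_part_eq:
  assumes "x \<in> C" "y \<in> C" "[balanced_part M x n = balanced_part M y n] (mod 3 ^ n)" "j \<le> n"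
  shows "balanced_part M x j = balanced_part M y j"
  using assms(4)
proof (induction j)
  case 0
  show ?case by (simp add: balanced_part_def)
next
  case (Suc j)
  have "[balanced_part M z n = balanced_part M z (Suc j)] (mod 3 ^ Suc j)" for z
    using residue_mod[OF Suc.prems] unfolding balanced_part_def cong_def
    by (intro mod_diff_cong) (simp_all del: power_Suc)
  moreover have "[balanced_part M x n = balanced_part M y n] (mod 3 ^ Suc j)"
    using assms(3) Suc.prems by (rule cong_dvd_modulus[OF _ le_imp_power_dvd])
  ultimately have "[balanced_part M x (Suc j) = balanced_part M y (Suc j)] (mod 3 ^ Suc j)"
    by (meson cong_sym cong_trans)
  then have "3 ^ j * 3 dvd (balanced_part M x (Suc j) - balanced_part M x j)
      - (balanced_part M y (Suc j) - balanced_part M y j)"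
    using Suc by (simp add: cong_iff_dvd_diff mult.commute)
  moreover obtain s t where
    s: "balanced_part M x (Suc j) - balanced_part M x j = 3 ^ j * s" "s \<in> {-1, 0, 1}" and
    t: "balanced_part M y (Suc j) - balanced_part M y j = 3 ^ j * t" "t \<in> {-1, 0, 1}"
    using balanced_part_step[OF assms(1), of j] balanced_part_step[OF assms(2), of j]
    by (metis insert_iff mult.right_neutral mult_minus1_right mult_zero_right singletonD)
  ultimately have "3 ^ j * 3 dvd 3 ^ j * (s - t)" by (simp add: right_diff_distrib)
  then have "3 dvd s - t" by simp
  then have "s = t" using s(2) t(2) by auto
  then show ?case using s(1) t(1) Suc by simp
qed

lemma balanced_part_eq_if_residue_eq:
  assumes "x \<in> C" "y \<in> C" "residue x n = residue y n" "j \<le> m + n"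
  shows "balanced_part M x j = balanced_part M y j"
  using balanced_part_eq[of x y "m + n" j] balanced_part_cong_iff[of x n y] assms by blast

section \<open>Growth of the weights\<close>

lemma weight_eq:
  assumes "x \<in> C" "y \<in> C" "residue x n = residue y n"
  shows "weight n x = weight n y"
  unfolding weight_def step_weight_def
  using balanced_part_eq_if_residue_eq[OF assms] by (intro prod.cong) auto

lemma step_weight_bounds: "1 \<le> step_weight M x j" "step_weight M x j \<le> sqrt 3"
  by (auto simp: step_weight_def)

lemma weight_ge_1: "1 \<le> weight n x"
  unfolding weight_def by (intro prod_ge_1) (rule step_weight_bounds)

lemma weight_Suc:
  "weight (Suc n) x * step_weight M x n = weight n x * step_weight M x (n + m)"
  \<comment> \<open>Both sides are the product over \<open>n..<Suc (n + m)\<close>.\<close>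
  using prod.atLeast_Suc_lessThan[of n "Suc (n + m)" "step_weight M x"]
  by (simp add: weight_def mult.commute)

lemma branching:
  assumes "x \<in> C" "y \<in> C" "residue x n = residue y n" "residue x (Suc n) \<noteq> residue y (Suc n)"
    and "m > 0"
  shows "weight (Suc n) x + weight (Suc n) y \<le> sqrt 3 * weight n x"
proof -
  note eq = balanced_part_eq_if_residue_eq[OF assms(1-3)]
  \<comment> \<open>As \<open>m > 0\<close>, the index \<open>Suc n\<close> is at most
    \<open>m + n\<close>, so the common prefix fixes the balanced digit at \<open>n\<close>.\<close>
  have "balanced_part M x n = balanced_part M y n" "balanced_part M x (Suc n) = balanced_part M y (Suc n)"
    using assms(5) by (auto intro!: eq)
  moreover have "residue z (Suc n) - residue z n \<in> {0, 3 ^ n} \<and>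
      residue (of_nat M * z) (Suc n) - residue (of_nat M * z) n \<in> {0, 3 ^ n}" if "z \<in> C" for z
    using that by (simp add: C_def omits_two_iff_residue)
  \<comment> \<open>One of \<open>x\<close>, \<open>y\<close> has digit 0 at place \<open>n\<close>,
    the other 1; their common balanced digit lies in both {0, 1} and {-1, 0}, so it
    vanishes.\<close>
  from this[OF assms(1)] this[OF assms(2)] calculation
  have "balanced_part M x (Suc n) = balanced_part M x n"
    using assms(3,4) unfolding balanced_part_def by auto
  ultimately have sw: "step_weight M x n = sqrt 3" "step_weight M y n = sqrt 3"
    by (simp_all add: step_weight_def)
  have "balanced_part M x (Suc (n + m)) \<noteq> balanced_part M y (Suc (n + m))"
    using balanced_part_cong_iff[of x "Suc n" y] assms(4) by (auto simp: add.commute)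
  moreover have "balanced_part M x (n + m) = balanced_part M y (n + m)" by (rule eq) simp
  \<comment> \<open>The balanced digits at \<open>n + m\<close> differ, so at most one of them is
    0.\<close>
  ultimately have "step_weight M x (n + m) + step_weight M y (n + m) \<le> sqrt 3 + 1"
    by (auto simp: step_weight_def)
  also have "sqrt 3 \<le> 2" by (rule real_le_lsqrt) auto
  finally have "weight n x * (step_weight M x (n + m) + step_weight M y (n + m)) \<le> weight n x * 3"
    using weight_ge_1[of n x] by (intro mult_left_mono) auto
  moreover have "(weight (Suc n) x + weight (Suc n) y) * sqrt 3
      = weight n x * (step_weight M x (n + m) + step_weight M y (n + m))"
    using weight_Suc[of n x] weight_Suc[of n y] weight_eq[OF assms(1-3)]
    by (simp add: sw algebra_simps)
  ultimately have "(weight (Suc n) x + weight (Suc n) y) * sqrt 3 \<le> (sqrt 3 * weight n x) * sqrt 3"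
    by (simp add: mult.assoc) (simp add: mult.commute flip: mult.assoc)
  then show ?thesis by (simp add: mult.commute)
qed

definition extensions :: "nat \<Rightarrow> nat \<Rightarrow> zthree \<Rightarrow> int set" where
  "extensions n k x = (\<lambda>y. residue y (n + k)) ` {y \<in> C. residue y n = residue x n}"

text \<open>Each induction step fixes one more digit, so \<open>n\<close> grows as \<open>k\<close>
  shrinks and both \<open>n\<close> and \<open>x\<close> must vary.\<close>

lemma card_extensions:
  assumes "x \<in> C" "m > 0"
  shows "real (card (extensions n k x)) \<le> sqrt 3 ^ k * weight n x"
  using assms(1)
proof (induction k arbitrary: n x)
  case 0
  have "card (extensions n 0 x) \<le> card {residue x n}"
    by (intro card_mono) (auto simp: extensions_def)
  then show ?case using weight_ge_1[of n x] by simp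
next
  case (Suc k)
  have res: "residue z (Suc n) - residue z n \<in> {0, 3 ^ n}" if "z \<in> C" for z
    using that by (simp add: C_def omits_two_iff_residue)
  show ?case
  proof (cases "\<exists>y\<in>C. residue y n = residue x n \<and> residue y (Suc n) \<noteq> residue x (Suc n)")
    case True
    then obtain y where y: "y \<in> C" "residue x n = residue y n" "residue x (Suc n) \<noteq> residue y (Suc n)"
      by metis
    \<comment> \<open>Only the digits 0 and 1 occur, so \<open>x\<close> and \<open>y\<close>
      represent all continuations by one digit.\<close>
    have "residue z (Suc n) = residue x (Suc n) \<or> residue z (Suc n) = residue y (Suc n)"
      if "z \<in> C" "residue z n = residue x n" for z
      using res[OF that(1)] res[OF y(1)] res[OF Suc.prems] y that by auto
    then have "extensions n (Suc k) x \<subseteq> extensions (Suc n) k x \<union> extensions (Suc n) k y"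
      unfolding extensions_def by auto
    then have "card (extensions n (Suc k) x) \<le> card (extensions (Suc n) k x \<union> extensions (Suc n) k y)"
      by (intro card_mono) (auto simp: extensions_def intro: finite_residue_image)
    also have "\<dots> \<le> card (extensions (Suc n) k x) + card (extensions (Suc n) k y)"
      by (rule card_Un_le)
    finally have "real (card (extensions n (Suc k) x))
        \<le> sqrt 3 ^ k * weight (Suc n) x + sqrt 3 ^ k * weight (Suc n) y"
      using Suc.IH[OF Suc.prems, of "Suc n"] Suc.IH[OF y(1), of "Suc n"] by linarith
    also have "\<dots> \<le> sqrt 3 ^ k * (sqrt 3 * weight n x)"
      unfolding distrib_left[symmetric]
      by (intro mult_left_mono branching Suc.prems y assms(2)) simp
    finally show ?thesis by (simp add: mult_ac)
  next
    case False
    then have "extensions n (Suc k) x \<subseteq> extensions (Suc n) k x"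
      unfolding extensions_def by auto
    then have "card (extensions n (Suc k) x) \<le> card (extensions (Suc n) k x)"
      by (intro card_mono) (auto simp: extensions_def intro: finite_residue_image)
    then have "real (card (extensions n (Suc k) x)) \<le> sqrt 3 ^ k * weight (Suc n) x"
      using Suc.IH[OF Suc.prems, of "Suc n"] by linarith
    \<comment> \<open>Without branching, the window drops a factor of at least 1 and gains one of at
      most \<open>sqrt 3\<close>.\<close>
    also have "weight (Suc n) x \<le> weight (Suc n) x * step_weight M x n"
      using weight_ge_1[of "Suc n" x] step_weight_bounds(1)[of x n] by simp
    also have "\<dots> \<le> weight n x * sqrt 3"
      unfolding weight_Suc
      using weight_ge_1[of n x] step_weight_bounds(2) by (intro mult_left_mono) auto
    finally show ?thesis by (simp add: mult_ac)
  qed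
qed

lemma hausdorff_dim_C:
  assumes "m > 0"
  shows "hausdorff_dim C \<le> ennreal (1 / 2)"
proof (cases "C = {}")
  case True
  then show ?thesis by (intro hausdorff_dim_le_box_counting[of _ _ 0]) auto
next
  case False
  then obtain x where x: "x \<in> C" by blast
  have "sqrt 3 ^ n = 3 powr (1 / 2 * real n)" for n
    by (simp add: powr_half_sqrt[symmetric] powr_power mult.commute)
  \<comment> \<open>All residues modulo \<open>3 ^ 0\<close> vanish, so every prefix extends the
    empty one.\<close>
  moreover have "(\<lambda>y. residue y n) ` C = extensions 0 n x" for n
    by (force simp: extensions_def)
  ultimately have "real (card ((\<lambda>y. residue y n) ` C)) \<le> weight 0 x * 3 powr (1 / 2 * real n)" for n
    using card_extensions[OF x assms, of 0 n] by (simp add: mult.commute)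
  then show ?thesis by (intro hausdorff_dim_le_box_counting) auto
qed

end

section \<open>Monotonicity and reduction to multipliers prime to 3\<close>

lemma hausdorff_dim_mono: "A \<subseteq> B \<Longrightarrow> hausdorff_dim A \<le> hausdorff_dim B"
proof -
  assume AB: "A \<subseteq> B"
  have "hausdorff_premeasure s d A \<le> hausdorff_premeasure s d B" for s d
    unfolding hausdorff_premeasure_def using AB by (intro Inf_superset_mono) blast
  then have "hausdorff_measure s A \<le> hausdorff_measure s B" for s
    unfolding hausdorff_measure_def by (intro SUP_mono) auto
  then have "hausdorff_measure s A = 0" if "hausdorff_measure s B = 0" for s
    using that by (metis le_zero_eq)
  then show ?thesis unfolding hausdorff_dim_def by (intro Inf_superset_mono) blast
qed

theorem theorem1p6:
  fixes M :: nat
  assumes "M > 0" and "\<And>j :: nat. M \<noteq> 3 ^ j"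
  shows "hausdorff_dim {x :: zthree. x \<in> omits_two \<and> of_nat M * x \<in> omits_two} \<le> ennreal (1 / 2)"
proof -
  have unit: "\<not> is_unit (3 :: nat)" and "M \<noteq> 0" using assms(1) by simp_all
  obtain k N where N: "M = 3 ^ k * N" "\<not> 3 dvd N"
    using multiplicity_decompose'[OF \<open>M \<noteq> 0\<close> unit] by metis
  \<comment> \<open>Otherwise \<open>M\<close> would be the power \<open>3 ^ k\<close>.\<close>
  have "N \<noteq> 1" using N(1) assms(2)[of k] by auto
  define D :: "zthree set" where "D = {x. x \<in> omits_two \<and> of_nat N * x \<in> omits_two}"
  have "{x :: zthree. x \<in> omits_two \<and> of_nat M * x \<in> omits_two} \<subseteq> D"
    using omits_two_three_power_mult[of k] by (auto simp: D_def N(1) mult.assoc)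
  also have "hausdorff_dim D \<le> ennreal (1 / 2)"
  proof (cases "N mod 3 = 2")
    case True
    \<comment> \<open>Only 0 can lie in \<open>D\<close>, so one class suffices at every
      level.\<close>
    have "(\<lambda>x. residue x n) ` D \<subseteq> {0}" for n
      using omits_two_multiple_eq_0[OF _ _ True] by (auto simp: D_def)
    then have "card ((\<lambda>x. residue x n) ` D) \<le> card {0 :: int}" for n
      by (intro card_mono) auto
    then have "real (card ((\<lambda>x. residue x n) ` D)) \<le> 1" for n by simp
    also have "1 \<le> 1 * 3 powr (1 / 2 * real n)" for n
      using ge_one_powr_ge_zero[of 3 "1 / 2 * real n"] by simp
    finally show ?thesis by (rule hausdorff_dim_le_box_counting[rotated]) simp
  next
    case False
    then have "N mod 3 = 1" using N(2) by presburger
    then have "3 dvd N - 1" "N - 1 \<noteq> 0" "N > 0" using \<open>N \<noteq> 1\<close> by presburger+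
    obtain m a where ma: "N - 1 = 3 ^ m * a" "\<not> 3 dvd a"
      using multiplicity_decompose'[OF \<open>N - 1 \<noteq> 0\<close> unit] by metis
    have "m > 0" using ma \<open>3 dvd N - 1\<close> by (cases m) auto
    interpret multiplier N a m
      using ma \<open>N > 0\<close> by unfold_locales auto
    show ?thesis using hausdorff_dim_C[OF \<open>m > 0\<close>] by (simp add: D_def C_def)
  qed
  finally (hausdorff_dim_mono[THEN order_trans]) show ?thesis .
qed

end
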